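(* Let $X$ be a Tychonoff space and let $\mathscr{P}$ be an ideal of closed sets in $X$ with $|X_\mathscr{P}|\geq 3$. Then $diam(G(C_\mathscr{P}(X)))=diam(AG(C_\mathscr{P}(X)))=2$.
   Context: $C(X)$ is the ring of all real valued continuous functions on the Tychonoff (completely regular Hausdorff) space $X$; $Z(f)=\{x\in X: f(x)=0\}$. An ideal of closed sets in $X$ is a nonempty family $\mathscr{P}$ of closed subsets of $X$ such that $A,B\in\mathscr{P}$ implies $A\cup B\in\mathscr{P}$, and $A\in\mathscr{P}$, $C\subset A$ with $C$ closed in $X$ implies $C\in\mathscr{P}$. $C_\mathscr{P}(X)=\{f\in C(X): cl_X(X\setminus Z(f))\in\mathscr{P}\}$, a commutative ring (possibly without identity). $X_\mathscr{P}$ is the set of all $x\in X$ having an open neighborhood $V$ with $cl_XV\in\mathscr{P}$. For a commutative ring $R$, $Z(R)^*$ is the set of nonzero zero divisors, i.e. nonzero $a\in R$ with $ab=0$ for some nonzero $b\in R$, and $ann(a)=\{r\in R: ra=0\}$. The annihilator graph $AG(R)$ is the simple graph with vertex set $Z(R)^*$ in which distinct $a,b$ are adjacent iff $ann(a)\cup ann(b)\neq ann(ab)$. On $C_\mathscr{P}(X)$ define the equivalence relation $f\sim g$ iff $int_XZ(f)\cap X_\mathscr{P}=int_XZ(g)\cap X_\mathscr{P}$. Fix a set $S\subset C_\mathscr{P}(X)$ containing exactly one element of each equivalence class, and put $V(C_\mathscr{P}(X))=\{f\in S\setminus\{0\}: int_XZ(f)\cap X_\mathscr{P}\neq\emptyset\}$,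 which is a subset of $Z(C_\mathscr{P}(X))^*$. $G(C_\mathscr{P}(X))$ is the induced subgraph of $AG(C_\mathscr{P}(X))$ with vertex set $V(C_\mathscr{P}(X))$. The diameter of a graph is the maximum of the distances (lengths of shortest paths) between its vertices. *)

theory Defs
  imports
    "HOL-Analysis.Analysis"
    "HOL-Library.Function_Algebras"
    "HOL-Library.Extended_Nat"
    "Graph_Theory.Digraph_Component"
    "Graph_Theory.Vertex_Walk"
begin

section \<open>Distance and diameter\<close>

text \<open>Simple graphs are represented as symmetric loop-free digraphs without multiple arcs.
  The distance is infinite if there is no path. A finite supremum in \<^typ>\<open>enat\<close> over a
  nonempty set is attained, so a finite diameter of a nonempty graph is a maximum.\<close>

definition graph_dist :: "('v, 'e) pre_digraph \<Rightarrow> 'v \<Rightarrow> 'v \<Rightarrow> enat" where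
  "graph_dist G u v = (INF p \<in> {p. vpath p G \<and> hd p = u \<and> last p = v}. enat (vwalk_length p))"

definition graph_diam :: "('v, 'e) pre_digraph \<Rightarrow> enat" where
  "graph_diam G = (SUP u \<in> verts G. SUP v \<in> verts G. graph_dist G u v)"

section \<open>The annihilator graph\<close>

text \<open>A commutative ring, possibly without identity, is given as a subset \<open>R\<close> of
  an ambient commutative ring, closed under the operations. All elements quantified over
  are taken from \<open>R\<close>, so the ambient ring plays no role.\<close>

definition nz_zero_divisors :: "'r::comm_ring set \<Rightarrow> 'r set" where
  "nz_zero_divisors R = {a \<in> R. a \<noteq> 0 \<and> (\<exists>b \<in> R. b \<noteq> 0 \<and> a * b = 0)}"

definition ann :: "'r::comm_ring set \<Rightarrow> 'r \<Rightarrow> 'r set" where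
  "ann R a = {r \<in> R. r * a = 0}"

definition annihilator_graph :: "'r::comm_ring set \<Rightarrow> ('r, 'r \<times> 'r) pre_digraph" where
  "annihilator_graph R =
    \<lparr> verts = nz_zero_divisors R,
      arcs = {(a, b). a \<in> nz_zero_divisors R \<and> b \<in> nz_zero_divisors R \<and> a \<noteq> b \<and>
                ann R a \<union> ann R b \<noteq> ann R (a * b)},
      tail = fst, head = snd \<rparr>"

section \<open>Rings of continuous functions and ideals of closed sets\<close>

text \<open>A real function on \<open>topspace X\<close> is represented by its extension by zero to the whole
  type. This makes equality of functions agree with HOL equality, and the ring operations are
  the pointwise ones of \<^theory>\<open>HOL-Library.Function_Algebras\<close>.\<close>

definition cont_functions :: "'a topology \<Rightarrow> ('a \<Rightarrow> real) set" where
  "cont_functions X =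
    {f. continuous_map X euclideanreal f \<and> (\<forall>x. x \<notin> topspace X \<longrightarrow> f x = 0)}"

definition zero_set :: "'a topology \<Rightarrow> ('a \<Rightarrow> real) \<Rightarrow> 'a set" where
  "zero_set X f = {x \<in> topspace X. f x = 0}"

definition ideal_of_closed_sets :: "'a topology \<Rightarrow> 'a set set \<Rightarrow> bool" where
  "ideal_of_closed_sets X P \<longleftrightarrow>
    P \<noteq> {} \<and> (\<forall>A \<in> P. closedin X A) \<and>
    (\<forall>A \<in> P. \<forall>B \<in> P. A \<union> B \<in> P) \<and>
    (\<forall>A \<in> P. \<forall>C. C \<subseteq> A \<and> closedin X C \<longrightarrow> C \<in> P)"

definition C_ideal :: "'a topology \<Rightarrow> 'a set set \<Rightarrow> ('a \<Rightarrow> real) set" where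
  "C_ideal X P = {f \<in> cont_functions X. X closure_of (topspace X - zero_set X f) \<in> P}"

definition X_ideal :: "'a topology \<Rightarrow> 'a set set \<Rightarrow> 'a set" where
  "X_ideal X P = {x \<in> topspace X. \<exists>V. openin X V \<and> x \<in> V \<and> X closure_of V \<in> P}"

definition int_zero :: "'a topology \<Rightarrow> 'a set set \<Rightarrow> ('a \<Rightarrow> real) \<Rightarrow> 'a set" where
  "int_zero X P f = (X interior_of zero_set X f) \<inter> X_ideal X P"

definition zero_equiv :: "'a topology \<Rightarrow> 'a set set \<Rightarrow> (('a \<Rightarrow> real) \<times> ('a \<Rightarrow> real)) set" where
  "zero_equiv X P =
    {(f, g). f \<in> C_ideal X P \<and> g \<in> C_ideal X P \<and> int_zero X P f = int_zero X P g}"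

definition class_representatives :: "'a topology \<Rightarrow> 'a set set \<Rightarrow> ('a \<Rightarrow> real) set \<Rightarrow> bool" where
  "class_representatives X P S \<longleftrightarrow>
    S \<subseteq> C_ideal X P \<and> (\<forall>E \<in> C_ideal X P // zero_equiv X P. \<exists>!f. f \<in> S \<inter> E)"

definition V_ideal :: "'a topology \<Rightarrow> 'a set set \<Rightarrow> ('a \<Rightarrow> real) set \<Rightarrow> ('a \<Rightarrow> real) set" where
  "V_ideal X P S = {f \<in> S - {0}. int_zero X P f \<noteq> {}}"

definition G_ideal ::
  "'a topology \<Rightarrow> 'a set set \<Rightarrow> ('a \<Rightarrow> real) set \<Rightarrow> ('a \<Rightarrow> real, ('a \<Rightarrow> real) \<times> ('a \<Rightarrow> real)) pre_digraph"
  where "G_ideal X P S = annihilator_graph (C_ideal X P) \<restriction> V_ideal X P S"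

lemma equiv_zero_equiv: "equiv (C_ideal X P) (zero_equiv X P)"
  by (rule equivI) (auto simp: zero_equiv_def refl_on_def sym_def trans_def)

lemma C_ideal_support_mono:
  assumes P: "ideal_of_closed_sets X P" and h: "h \<in> cont_functions X"
    and A: "A \<in> P" and sub: "topspace X - zero_set X h \<subseteq> A"
  shows "h \<in> C_ideal X P"
proof -
  have "closedin X A" using P A by (auto simp: ideal_of_closed_sets_def)
  then have "X closure_of (topspace X - zero_set X h) \<subseteq> A"
    using sub by (intro closure_of_minimal)
  then have "X closure_of (topspace X - zero_set X h) \<in> P"
    using P A closedin_closure_of unfolding ideal_of_closed_sets_def by blast
  then show ?thesis using h by (simp add: C_ideal_def)
qed

lemma C_ideal_subring:
  assumes P: "ideal_of_closed_sets X P"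
  shows "0 \<in> C_ideal X P"
    and "f \<in> C_ideal X P \<Longrightarrow> g \<in> C_ideal X P \<Longrightarrow> f - g \<in> C_ideal X P"
    and "f \<in> C_ideal X P \<Longrightarrow> g \<in> C_ideal X P \<Longrightarrow> f * g \<in> C_ideal X P"
proof -
  obtain A where "A \<in> P" using P by (auto simp: ideal_of_closed_sets_def)
  then show "0 \<in> C_ideal X P"
    by (intro C_ideal_support_mono[OF P])
      (auto simp: cont_functions_def zero_set_def zero_fun_def)
next
  assume f: "f \<in> C_ideal X P" and g: "g \<in> C_ideal X P"
  let ?A = "X closure_of (topspace X - zero_set X f) \<union> X closure_of (topspace X - zero_set X g)"
  have A: "?A \<in> P"
    using f g P by (simp add: C_ideal_def ideal_of_closed_sets_def)
  have sub: "(topspace X - zero_set X f) \<union> (topspace X - zero_set X g) \<subseteq> ?A"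
    by (intro Un_mono closure_of_subset) auto
  have "f - g \<in> cont_functions X"
    using f g by (auto simp: C_ideal_def cont_functions_def fun_diff_def
        intro: continuous_map_diff)
  moreover have "topspace X - zero_set X (f - g) \<subseteq> ?A"
    by (rule order_trans[OF _ sub]) (auto simp: zero_set_def)
  ultimately show "f - g \<in> C_ideal X P"
    by (rule C_ideal_support_mono[OF P _ A])
  have "f * g \<in> cont_functions X"
    using f g by (auto simp: C_ideal_def cont_functions_def times_fun_def
        intro: continuous_map_real_mult)
  moreover have "topspace X - zero_set X (f * g) \<subseteq> ?A"
    by (rule order_trans[OF _ sub]) (auto simp: zero_set_def)
  ultimately show "f * g \<in> C_ideal X P"
    by (rule C_ideal_support_mono[OF P _ A])
qed

end

theory Submission
  imports Defs
begin

text \<open>The rings \<^term>\<open>C_ideal X P\<close> enter the argument only through their annihilators.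
  In a reduced commutative ring two vertices of the annihilator graph are adjacent exactly when
  their annihilators are incomparable (lemma \<open>dominates_annihilator_graph_iff\<close>). If
  \<open>ann a \<subseteq> ann b\<close>, any nonzero \<open>c\<close> killed by \<open>a\<close> is
  also killed by \<open>b\<close>, and since nonzero elements have nonzero squares, \<open>c\<close> and each of
  \<open>a\<close>, \<open>b\<close> have incomparable annihilators; so nonadjacent vertices have a
  common neighbour and the diameter is at most 2. It is not smaller as soon as the ring contains
  three nonzero, pairwise orthogonal elements \<open>d\<close>, \<open>e\<close>,
  \<open>h\<close>: then \<open>d + e\<close> and \<open>d\<close> are zero divisors, killed by
  \<open>h\<close>, with \<open>ann (d + e) \<subset> ann d\<close>.

  As adjacency depends on annihilators only, nothing changes when the graph is restricted to a set
  of vertices that meets every class of zero divisors with equal annihilator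
  (lemma \<open>graph_diam_annihilator_graph_restrict\<close>). This covers both graphs at once,
  because the annihilator of \<open>f\<close> consists of the functions whose cozero set lies in
  \<^term>\<open>int_zero X P f\<close>, so that equivalent functions have equal annihilators. The
  orthogonal elements are bump functions at three points of \<^term>\<open>X_ideal X P\<close> with
  disjoint neighbourhoods.\<close>

section \<open>Graphs of diameter two\<close>

lemma graph_dist_le:
  assumes "vpath p G" "hd p = u" "last p = v"
  shows "graph_dist G u v \<le> enat (vwalk_length p)"
  unfolding graph_dist_def using assms by (intro INF_lower) auto

lemma graph_diam_eq_2:
  assumes common: "\<And>u v. \<lbrakk>u \<in> verts G; v \<in> verts G; u \<noteq> v; \<not> u \<rightarrow>\<^bsub>G\<^esub> v\<rbrakk> \<Longrightarrow>
      \<exists>w \<in> verts G. u \<rightarrow>\<^bsub>G\<^esub> w \<and> w \<rightarrow>\<^bsub>G\<^esub> v \<and> w \<noteq> u \<and> w \<noteq> v"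
    and a: "a \<in> verts G" and b: "b \<in> verts G" and "a \<noteq> b" and nadj: "\<not> a \<rightarrow>\<^bsub>G\<^esub> b"
  shows "graph_diam G = 2"
proof (rule antisym)
  have "graph_dist G u v \<le> 2" if u: "u \<in> verts G" and v: "v \<in> verts G" for u v
  proof -
    consider "u = v" | "u \<noteq> v" "u \<rightarrow>\<^bsub>G\<^esub> v" | "u \<noteq> v" "\<not> u \<rightarrow>\<^bsub>G\<^esub> v" by blast
    then show ?thesis
    proof cases
      case 1
      have "graph_dist G u v \<le> enat (vwalk_length [u])"
        using u 1 by (intro graph_dist_le) (auto simp: vpath_def vwalk_def)
      also have "\<dots> \<le> enat 2" by (simp add: vwalk_length_def)
      finally show ?thesis by (simp add: numeral_eq_enat)
    next
      case 2
      have "graph_dist G u v \<le> enat (vwalk_length [u, v])"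
        using u v 2 by (intro graph_dist_le) (auto simp: vpath_def vwalk_def)
      also have "\<dots> \<le> enat 2" by (simp add: vwalk_length_def)
      finally show ?thesis by (simp add: numeral_eq_enat)
    next
      case 3
      then obtain w where w: "w \<in> verts G" "u \<rightarrow>\<^bsub>G\<^esub> w" "w \<rightarrow>\<^bsub>G\<^esub> v" "w \<noteq> u" "w \<noteq> v"
        using common u v by blast
      have "graph_dist G u v \<le> enat (vwalk_length [u, w, v])"
        using u v w 3 by (intro graph_dist_le) (auto simp: vpath_def vwalk_def)
      also have "\<dots> \<le> enat 2" by (simp add: vwalk_length_def)
      finally show ?thesis by (simp add: numeral_eq_enat)
    qed
  qed
  then show "graph_diam G \<le> 2"
    unfolding graph_diam_def by (intro SUP_least)
next
  have "2 \<le> enat (vwalk_length p)" if p: "vpath p G" "hd p = a" "last p = b" for p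
  proof -
    obtain q where q: "p = a # q" using p by (cases p) (auto simp: vpath_def vwalk_def)
    with p \<open>a \<noteq> b\<close> obtain y r where r: "q = y # r" by (cases q) auto
    have "r \<noteq> []" using p q r nadj by (auto simp: vpath_def vwalk_def)
    then have "2 \<le> vwalk_length p" using q r by (cases r) (auto simp: vwalk_length_def)
    then show ?thesis by (simp add: numeral_eq_enat)
  qed
  then have "2 \<le> graph_dist G a b"
    unfolding graph_dist_def by (intro INF_greatest) auto
  also have "\<dots> \<le> (SUP v \<in> verts G. graph_dist G a v)" using b by (rule SUP_upper)
  also have "\<dots> \<le> graph_diam G" unfolding graph_diam_def using a by (rule SUP_upper)
  finally show "2 \<le> graph_diam G" .
qed

section \<open>Annihilator graphs of reduced rings\<close>

locale reduced_subring =
  fixes R :: "'r::comm_ring set"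
  assumes zero_closed: "0 \<in> R"
    and diff_closed: "a \<in> R \<Longrightarrow> b \<in> R \<Longrightarrow> a - b \<in> R"
    and mult_closed: "a \<in> R \<Longrightarrow> b \<in> R \<Longrightarrow> a * b \<in> R"
    and reduced: "a \<in> R \<Longrightarrow> a * a = 0 \<Longrightarrow> a = 0"
begin

lemma add_closed: "a \<in> R \<Longrightarrow> b \<in> R \<Longrightarrow> a + b \<in> R"
  using diff_closed[of a "0 - b"] diff_closed[of 0 b] zero_closed by simp

lemma mult_square_eq_0:
  assumes "r \<in> R" "b \<in> R" "r * b * b = 0"
  shows "r * b = 0"
proof (rule reduced)
  show "r * b \<in> R" using assms mult_closed by blast
  have "r * b * (r * b) = r * (r * b * b)" by (simp add: algebra_simps)
  then show "r * b * (r * b) = 0" using assms by simp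
qed

lemma ann_mult_subset:
  assumes "a \<in> R" "b \<in> R" "ann R a \<subseteq> ann R b"
  shows "ann R (a * b) = ann R b"
proof
  show "ann R (a * b) \<subseteq> ann R b"
  proof
    fix r assume "r \<in> ann R (a * b)"
    then have r: "r \<in> R" "r * b * a = 0" by (auto simp: ann_def algebra_simps)
    then have "r * b \<in> ann R b" using assms mult_closed by (auto simp: ann_def)
    then show "r \<in> ann R b" using mult_square_eq_0 r assms by (auto simp: ann_def)
  qed
  have "r * (a * b) = a * (r * b)" for r by (simp add: algebra_simps)
  then show "ann R b \<subseteq> ann R (a * b)" by (auto simp: ann_def)
qed

text \<open>If neither annihilator contains the other, elements \<open>s\<close>, \<open>t\<close> that witness
  this add up to an element of \<open>ann (a * b)\<close> that lies in neither of them. For comparable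
  annihilators, \<open>ann (a * b)\<close> is the larger one, by reducedness.\<close>

lemma ann_union_neq_iff:
  assumes a: "a \<in> R" and b: "b \<in> R"
  shows "ann R a \<union> ann R b \<noteq> ann R (a * b) \<longleftrightarrow> \<not> ann R a \<subseteq> ann R b \<and> \<not> ann R b \<subseteq> ann R a"
proof
  assume "ann R a \<union> ann R b \<noteq> ann R (a * b)"
  then show "\<not> ann R a \<subseteq> ann R b \<and> \<not> ann R b \<subseteq> ann R a"
    using ann_mult_subset[OF a b] ann_mult_subset[OF b a] by (auto simp: mult.commute)
next
  assume "\<not> ann R a \<subseteq> ann R b \<and> \<not> ann R b \<subseteq> ann R a"
  then obtain s t where s: "s \<in> R" "s * a = 0" "s * b \<noteq> 0"
    and t: "t \<in> R" "t * b = 0" "t * a \<noteq> 0"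
    by (auto simp: ann_def)
  have "(s + t) * (a * b) = (s * a) * b + a * (t * b)" by (simp add: algebra_simps)
  then have "s + t \<in> ann R (a * b)" using s t add_closed by (auto simp: ann_def)
  moreover have "s + t \<notin> ann R a \<union> ann R b" using s t by (auto simp: ann_def distrib_right)
  ultimately show "ann R a \<union> ann R b \<noteq> ann R (a * b)" by blast
qed

lemma dominates_annihilator_graph_iff:
  assumes "W \<subseteq> nz_zero_divisors R" "a \<in> W" "b \<in> W"
  shows "a \<rightarrow>\<^bsub>annihilator_graph R \<restriction> W\<^esub> b \<longleftrightarrow> \<not> ann R a \<subseteq> ann R b \<and> \<not> ann R b \<subseteq> ann R a"
proof -
  have "a \<rightarrow>\<^bsub>annihilator_graph R \<restriction> W\<^esub> b \<longleftrightarrow> a \<noteq> b \<and> ann R a \<union> ann R b \<noteq> ann R (a * b)"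
    using assms by (force simp: induce_subgraph_def annihilator_graph_def arcs_ends_def arc_to_ends_def)
  moreover have "a \<in> R" "b \<in> R" using assms by (auto simp: nz_zero_divisors_def)
  ultimately show ?thesis using ann_union_neq_iff by auto
qed

lemma orthogonal_incomparable:
  assumes "a \<in> R" "b \<in> R" "a \<noteq> 0" "b \<noteq> 0" "a * b = 0"
  shows "\<not> ann R a \<subseteq> ann R b" "\<not> ann R b \<subseteq> ann R a"
  using assms reduced by (auto simp: ann_def mult.commute)

text \<open>A nonzero \<open>c\<close> in the smaller of two comparable annihilators is orthogonal to both
  elements.\<close>

lemma ex_common_incomparable:
  assumes a: "a \<in> nz_zero_divisors R" and b: "b \<in> nz_zero_divisors R"
    and sub: "ann R a \<subseteq> ann R b"
  obtains c where "c \<in> nz_zero_divisors R"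
    "\<not> ann R c \<subseteq> ann R a" "\<not> ann R a \<subseteq> ann R c" "\<not> ann R c \<subseteq> ann R b" "\<not> ann R b \<subseteq> ann R c"
proof -
  obtain c where c: "c \<in> R" "c \<noteq> 0" "c * a = 0"
    using a by (auto simp: nz_zero_divisors_def mult.commute)
  then have cb: "c * b = 0" using sub by (auto simp: ann_def)
  have ab: "a \<in> R" "a \<noteq> 0" "b \<in> R" "b \<noteq> 0" using a b by (auto simp: nz_zero_divisors_def)
  then have "c \<in> nz_zero_divisors R" using c by (auto simp: nz_zero_divisors_def)
  then show thesis
    using that orthogonal_incomparable[of c a] orthogonal_incomparable[of c b] c cb ab by blast
qed

text \<open>Multiplying \<open>r * (d + e) = 0\<close> by \<open>d\<close> leaves
  \<open>r * d * d = 0\<close>. The inclusion is strict because of \<open>e\<close> itself.\<close>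

lemma ann_add_orthogonal_psubset:
  assumes d: "d \<in> R" and e: "e \<in> R" "e \<noteq> 0" and "d * e = 0"
  shows "ann R (d + e) \<subset> ann R d"
proof
  show "ann R (d + e) \<subseteq> ann R d"
  proof
    fix r assume "r \<in> ann R (d + e)"
    then have r: "r \<in> R" "r * (d + e) = 0" by (auto simp: ann_def)
    have "r * d * d = r * (d + e) * d - r * (d * e)" by (simp add: algebra_simps)
    then have "r * d * d = 0" using r \<open>d * e = 0\<close> by simp
    then show "r \<in> ann R d" using r d mult_square_eq_0 by (auto simp: ann_def)
  qed
  have "e \<in> ann R d" using e \<open>d * e = 0\<close> by (auto simp: ann_def mult.commute)
  moreover have "e \<notin> ann R (d + e)"
    using e \<open>d * e = 0\<close> reduced by (auto simp: ann_def distrib_left mult.commute)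
  ultimately show "ann R (d + e) \<noteq> ann R d" by blast
qed

text \<open>The representatives of \<open>d + e\<close> and \<open>d\<close> in \<open>W\<close> are distinct and not
  adjacent, and a common neighbour found in the full graph may be replaced by its
  representative.\<close>

lemma graph_diam_annihilator_graph_restrict:
  assumes W: "W \<subseteq> nz_zero_divisors R"
    and rep: "\<And>c. c \<in> nz_zero_divisors R \<Longrightarrow> \<exists>w \<in> W. ann R w = ann R c"
    and d: "d \<in> R" "d \<noteq> 0" and e: "e \<in> R" "e \<noteq> 0" and h: "h \<in> R" "h \<noteq> 0"
    and orth: "d * e = 0" "d * h = 0" "e * h = 0"
  shows "graph_diam (annihilator_graph R \<restriction> W) = 2"
proof -
  let ?G = "annihilator_graph R \<restriction> W"
  have verts: "verts ?G = W"
    by simp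
  have psub: "ann R (d + e) \<subset> ann R d"
    using ann_add_orthogonal_psubset d e orth by blast
  have "d + e \<noteq> 0"
  proof
    assume "d + e = 0"
    then have "d * d = 0" using orth by (metis add.right_neutral distrib_left mult_zero_right)
    then show False using d reduced by blast
  qed
  then have "d + e \<in> nz_zero_divisors R" "d \<in> nz_zero_divisors R"
    using d e h orth add_closed by (auto simp: nz_zero_divisors_def distrib_right)
  then obtain a b where a: "a \<in> W" "ann R a = ann R (d + e)" and b: "b \<in> W" "ann R b = ann R d"
    using rep by metis
  show ?thesis
  proof (rule graph_diam_eq_2)
    show "a \<in> verts ?G" "b \<in> verts ?G" "a \<noteq> b" using a b verts psub by auto
    show "\<not> a \<rightarrow>\<^bsub>?G\<^esub> b"
      using dominates_annihilator_graph_iff[OF W, of a b] a b psub by auto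
  next
    fix u v assume "u \<in> verts ?G" "v \<in> verts ?G" and nadj: "\<not> u \<rightarrow>\<^bsub>?G\<^esub> v"
    then have u: "u \<in> W" and v: "v \<in> W" using verts by auto
    have zd: "u \<in> nz_zero_divisors R" "v \<in> nz_zero_divisors R" using u v W by auto
    obtain c where c: "c \<in> nz_zero_divisors R"
      "\<not> ann R c \<subseteq> ann R u" "\<not> ann R u \<subseteq> ann R c" "\<not> ann R c \<subseteq> ann R v" "\<not> ann R v \<subseteq> ann R c"
    proof (cases "ann R u \<subseteq> ann R v")
      case True
      then show thesis by (rule ex_common_incomparable[OF zd]) (rule that)
    next
      case False
      then have "ann R v \<subseteq> ann R u"
        using nadj dominates_annihilator_graph_iff[OF W u v] by blast
      then show thesis by (rule ex_common_incomparable[OF zd(2,1)]) (rule that)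
    qed
    obtain w where w: "w \<in> W" "ann R w = ann R c" using rep[OF c(1)] by blast
    have "u \<rightarrow>\<^bsub>?G\<^esub> w" "w \<rightarrow>\<^bsub>?G\<^esub> v"
      using dominates_annihilator_graph_iff[OF W u w(1)] dominates_annihilator_graph_iff[OF W w(1) v]
        c w by simp_all
    moreover have "w \<noteq> u" "w \<noteq> v" using c w by auto
    ultimately show "\<exists>w \<in> verts ?G. u \<rightarrow>\<^bsub>?G\<^esub> w \<and> w \<rightarrow>\<^bsub>?G\<^esub> v \<and> w \<noteq> u \<and> w \<noteq> v"
      using w verts by blast
  qed
qed

end

section \<open>Annihilators in rings of continuous functions\<close>

lemma reduced_subring_C_ideal:
  assumes "ideal_of_closed_sets X P"
  shows "reduced_subring (C_ideal X P)"
  using C_ideal_subring[OF assms] by unfold_locales (auto simp: fun_eq_iff)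

lemma openin_cozero:
  assumes "f \<in> C_ideal X P"
  shows "openin X (topspace X - zero_set X f)"
proof -
  have "closedin X {x \<in> topspace X. f x \<in> {0}}"
    using assms by (intro closedin_continuous_map_preimage[of _ euclideanreal])
      (auto simp: C_ideal_def cont_functions_def)
  then show ?thesis by (simp add: zero_set_def openin_diff)
qed

text \<open>A cozero set that misses that of \<open>f\<close> is an open subset of the zero set of
  \<open>f\<close>, hence lies in its interior; and the support condition puts the cozero set of every
  member of the ring inside \<^term>\<open>X_ideal X P\<close>.\<close>

lemma ann_C_ideal:
  assumes f: "f \<in> C_ideal X P"
  shows "ann (C_ideal X P) f =
    {r \<in> C_ideal X P. topspace X - zero_set X r \<subseteq> int_zero X P f}"
proof -
  have "r * f = 0 \<longleftrightarrow> topspace X - zero_set X r \<subseteq> int_zero X P f" if r: "r \<in> C_ideal X P" for r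
  proof
    assume rf: "r * f = 0"
    have "r x * f x = 0" for x using fun_cong[OF rf, of x] by simp
    then have "topspace X - zero_set X r \<subseteq> zero_set X f" by (auto simp: zero_set_def)
    then have "topspace X - zero_set X r \<subseteq> X interior_of zero_set X f"
      using openin_cozero[OF r] by (rule interior_of_maximal)
    moreover have "topspace X - zero_set X r \<subseteq> X_ideal X P"
      using openin_cozero[OF r] r by (auto simp: X_ideal_def C_ideal_def)
    ultimately show "topspace X - zero_set X r \<subseteq> int_zero X P f" by (simp add: int_zero_def)
  next
    assume "topspace X - zero_set X r \<subseteq> int_zero X P f"
    then have sub: "topspace X - zero_set X r \<subseteq> zero_set X f"
      using interior_of_subset[of X "zero_set X f"] by (auto simp: int_zero_def)
    show "r * f = 0"
    proof
      fix x show "(r * f) x = 0 x"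
        using sub r by (cases "x \<in> topspace X") (auto simp: zero_set_def C_ideal_def cont_functions_def)
    qed
  qed
  then show ?thesis by (auto simp: ann_def)
qed

lemma C_ideal_bump:
  assumes X: "completely_regular_space X" and P: "ideal_of_closed_sets X P"
    and x: "x \<in> X_ideal X P" and U: "openin X U" "x \<in> U"
  obtains f where "f \<in> C_ideal X P" "f x = 1" "topspace X - zero_set X f \<subseteq> U"
proof -
  obtain V where V: "openin X V" "x \<in> V" "X closure_of V \<in> P"
    using x by (auto simp: X_ideal_def)
  have "closedin X (topspace X - (U \<inter> V))" "x \<in> topspace X - (topspace X - (U \<inter> V))"
    using U V openin_subset by blast+
  then obtain f where f: "continuous_map X euclideanreal f" "f x = 0"
      "f ` (topspace X - (U \<inter> V)) \<subseteq> {1}"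
    using X unfolding completely_regular_space_alt by meson
  define g where "g y = (if y \<in> topspace X then 1 - f y else 0)" for y
  have "continuous_map X euclideanreal (\<lambda>y. 1 - f y)"
    using f by (intro continuous_map_diff) auto
  then have "continuous_map X euclideanreal g"
    by (rule continuous_map_eq) (simp add: g_def)
  then have g: "g \<in> cont_functions X" by (simp add: cont_functions_def g_def)
  have coz: "topspace X - zero_set X g \<subseteq> U \<inter> V"
    using f by (auto simp: zero_set_def g_def)
  have "V \<subseteq> X closure_of V" using V by (simp add: closure_of_subset openin_subset)
  then have "g \<in> C_ideal X P" using C_ideal_support_mono[OF P g V(3)] coz by blast
  moreover have "g x = 1" using f x by (simp add: g_def X_ideal_def)
  ultimately show thesis using that coz by blast
qed

lemma nz_zero_divisors_C_ideal:
  assumes X: "completely_regular_space X" and P: "ideal_of_closed_sets X P"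
  shows "nz_zero_divisors (C_ideal X P) = {f \<in> C_ideal X P. f \<noteq> 0 \<and> int_zero X P f \<noteq> {}}"
proof -
  have "(\<exists>g \<in> C_ideal X P. g \<noteq> 0 \<and> f * g = 0) \<longleftrightarrow> int_zero X P f \<noteq> {}"
    if f: "f \<in> C_ideal X P" for f
  proof
    assume "\<exists>g \<in> C_ideal X P. g \<noteq> 0 \<and> f * g = 0"
    then obtain g where g: "g \<in> C_ideal X P" "g \<noteq> 0" "g * f = 0" by (auto simp: mult.commute)
    obtain x where "g x \<noteq> 0" using g by (auto simp: fun_eq_iff)
    then have "x \<in> topspace X - zero_set X g"
      using g by (auto simp: zero_set_def C_ideal_def cont_functions_def)
    moreover have "g \<in> ann (C_ideal X P) f" using g by (simp add: ann_def)
    ultimately show "int_zero X P f \<noteq> {}" using ann_C_ideal[OF f] by blast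
  next
    assume "int_zero X P f \<noteq> {}"
    then obtain x where x: "x \<in> X interior_of zero_set X f" "x \<in> X_ideal X P"
      by (auto simp: int_zero_def)
    then obtain g where g: "g \<in> C_ideal X P" "g x = 1"
        "topspace X - zero_set X g \<subseteq> X interior_of zero_set X f"
      using C_ideal_bump[OF X P, of x "X interior_of zero_set X f"] by auto
    then have "topspace X - zero_set X g \<subseteq> int_zero X P f"
      using openin_cozero g by (auto simp: int_zero_def X_ideal_def C_ideal_def)
    then have "g * f = 0" using ann_C_ideal[OF f] g by (auto simp: ann_def)
    moreover have "g \<noteq> 0" using g by force
    ultimately show "\<exists>g \<in> C_ideal X P. g \<noteq> 0 \<and> f * g = 0"
      using g by (auto simp: mult.commute)
  qed
  then show ?thesis by (auto simp: nz_zero_divisors_def)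
qed

lemma C_ideal_mult_eq_0:
  assumes "f \<in> C_ideal X P"
    and "topspace X - zero_set X f \<subseteq> U" "topspace X - zero_set X g \<subseteq> V" "disjnt U V"
  shows "f * g = 0"
proof
  fix x show "(f * g) x = 0 x"
    using assms by (cases "x \<in> topspace X")
      (auto simp: zero_set_def disjnt_iff C_ideal_def cont_functions_def)
qed

lemma V_ideal_subset_nz_zero_divisors:
  assumes "completely_regular_space X" "ideal_of_closed_sets X P" "class_representatives X P S"
  shows "V_ideal X P S \<subseteq> nz_zero_divisors (C_ideal X P)"
  using assms by (auto simp: nz_zero_divisors_C_ideal V_ideal_def class_representatives_def)

lemma V_ideal_representative:
  assumes X: "completely_regular_space X" and P: "ideal_of_closed_sets X P"
    and S: "class_representatives X P S" and c: "c \<in> nz_zero_divisors (C_ideal X P)"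
  shows "\<exists>w \<in> V_ideal X P S. ann (C_ideal X P) w = ann (C_ideal X P) c"
proof -
  have c': "c \<in> C_ideal X P" "c \<noteq> 0" "int_zero X P c \<noteq> {}"
    using c by (auto simp: nz_zero_divisors_C_ideal[OF X P])
  then have "zero_equiv X P `` {c} \<in> C_ideal X P // zero_equiv X P" by (simp add: quotientI)
  then obtain w where w: "w \<in> S" "(c, w) \<in> zero_equiv X P"
    using S unfolding class_representatives_def by blast
  then have wC: "w \<in> C_ideal X P" and eq: "int_zero X P w = int_zero X P c"
    by (auto simp: zero_equiv_def)
  have ann: "ann (C_ideal X P) w = ann (C_ideal X P) c"
    using ann_C_ideal[OF wC] ann_C_ideal[OF c'(1)] eq by simp
  \<comment> \<open>The representative cannot be \<open>0\<close>, whose annihilator is the whole ring: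
    in a reduced ring \<open>c\<close> does not annihilate itself.\<close>
  have "c \<notin> ann (C_ideal X P) c"
    using c' reduced_subring.reduced[OF reduced_subring_C_ideal[OF P]] by (auto simp: ann_def)
  moreover have "c \<in> ann (C_ideal X P) 0" using c' by (simp add: ann_def)
  ultimately have "w \<noteq> 0" using ann by metis
  then show ?thesis using w c' eq ann by (auto simp: V_ideal_def)
qed

lemma C_ideal_three_orthogonal:
  assumes X: "completely_regular_space X" "Hausdorff_space X" and P: "ideal_of_closed_sets X P"
    and three: "infinite (X_ideal X P) \<or> card (X_ideal X P) \<ge> 3"
  obtains d e h where "d \<in> C_ideal X P" "d \<noteq> 0" "e \<in> C_ideal X P" "e \<noteq> 0"
    "h \<in> C_ideal X P" "h \<noteq> 0" "d * e = 0" "d * h = 0" "e * h = 0"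
proof -
  obtain T where T: "T \<subseteq> X_ideal X P" "card T = 3"
    using three infinite_arbitrarily_large[of "X_ideal X P" 3]
      obtain_subset_with_card_n[of 3 "X_ideal X P"] by metis
  then obtain x y z where xyz: "x \<noteq> y" "x \<noteq> z" "y \<noteq> z"
      "x \<in> X_ideal X P" "y \<in> X_ideal X P" "z \<in> X_ideal X P"
    by (auto simp: card_3_iff)
  then have top: "x \<in> topspace X" "y \<in> topspace X" "z \<in> topspace X" by (auto simp: X_ideal_def)
  have sep: "\<exists>U V. openin X U \<and> openin X V \<and> p \<in> U \<and> q \<in> V \<and> disjnt U V"
    if "p \<in> topspace X" "q \<in> topspace X" "p \<noteq> q" for p q
    using X(2) that unfolding Hausdorff_space_def by blast
  obtain A1 B1 where 1: "openin X A1" "openin X B1" "x \<in> A1" "y \<in> B1" "disjnt A1 B1"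
    using sep top xyz by metis
  obtain A2 C2 where 2: "openin X A2" "openin X C2" "x \<in> A2" "z \<in> C2" "disjnt A2 C2"
    using sep top xyz by metis
  obtain B3 C3 where 3: "openin X B3" "openin X C3" "y \<in> B3" "z \<in> C3" "disjnt B3 C3"
    using sep top xyz by metis
  obtain d where d: "d \<in> C_ideal X P" "d x = 1" "topspace X - zero_set X d \<subseteq> A1 \<inter> A2"
    using C_ideal_bump[OF X(1) P xyz(4), of "A1 \<inter> A2"] 1 2 by auto
  obtain e where e: "e \<in> C_ideal X P" "e y = 1" "topspace X - zero_set X e \<subseteq> B1 \<inter> B3"
    using C_ideal_bump[OF X(1) P xyz(5), of "B1 \<inter> B3"] 1 3 by auto
  obtain h where h: "h \<in> C_ideal X P" "h z = 1" "topspace X - zero_set X h \<subseteq> C2 \<inter> C3"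
    using C_ideal_bump[OF X(1) P xyz(6), of "C2 \<inter> C3"] 2 3 by auto
  have "d * e = 0" by (rule C_ideal_mult_eq_0[OF d(1) d(3) e(3)]) (use 1 in \<open>auto simp: disjnt_iff\<close>)
  moreover have "d * h = 0" by (rule C_ideal_mult_eq_0[OF d(1) d(3) h(3)]) (use 2 in \<open>auto simp: disjnt_iff\<close>)
  moreover have "e * h = 0" by (rule C_ideal_mult_eq_0[OF e(1) e(3) h(3)]) (use 3 in \<open>auto simp: disjnt_iff\<close>)
  moreover have "d \<noteq> 0" "e \<noteq> 0" "h \<noteq> 0" using d(2) e(2) h(2) by force+
  ultimately show thesis using that d e h by blast
qed

theorem corollary4p7:
  fixes X :: "'a topology" and P :: "'a set set" and S :: "('a \<Rightarrow> real) set"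
  assumes "completely_regular_space X" and "Hausdorff_space X"
    and "ideal_of_closed_sets X P"
    and "infinite (X_ideal X P) \<or> card (X_ideal X P) \<ge> 3"
    and "class_representatives X P S"
  shows "graph_diam (G_ideal X P S) = graph_diam (annihilator_graph (C_ideal X P)) \<and>
    graph_diam (annihilator_graph (C_ideal X P)) = 2"
proof -
  interpret reduced_subring "C_ideal X P" by (rule reduced_subring_C_ideal[OF assms(3)])
  obtain d e h where "d \<in> C_ideal X P" "d \<noteq> 0" "e \<in> C_ideal X P" "e \<noteq> 0"
    "h \<in> C_ideal X P" "h \<noteq> 0" "d * e = 0" "d * h = 0" "e * h = 0"
    using C_ideal_three_orthogonal[OF assms(1-4)] by blast
  note diam = graph_diam_annihilator_graph_restrict[OF _ _ this]
  have "graph_diam (G_ideal X P S) = 2"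
    unfolding G_ideal_def
    using V_ideal_subset_nz_zero_divisors V_ideal_representative assms by (intro diam) blast+
  moreover have "annihilator_graph (C_ideal X P) \<restriction> nz_zero_divisors (C_ideal X P) =
      annihilator_graph (C_ideal X P)"
    by (auto simp: annihilator_graph_def induce_subgraph_def)
  then have "graph_diam (annihilator_graph (C_ideal X P)) = 2"
    using diam[of "nz_zero_divisors (C_ideal X P)"] by auto
  ultimately show ?thesis by simp
qed

end
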